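(* Let $G$ be a group, and define binary operations on $G$ by $x*y=[x,y]$ and $x\bullet y=[y,x]$ for all $x,y\in G$. Then: (i) $(G,*,\bullet)$ is a double semigroup if and only if $G$ is nilpotent of class $2$; and (ii) $(G,*,\bullet)$ is a proper double semigroup if and only if $G$ is a nonabelian group which is nilpotent of class $2$ and whose derived group $G'$ is not of exponent $2$.
   Context: For elements of a group, $[x,y]=x^{-1}y^{-1}xy$. $G'$ denotes the derived (commutator) subgroup of $G$. A group is of exponent $2$ if the square of each of its elements is trivial. With $\gamma_n(G)$ the $n$-th term of the lower central series of $G$ ($\gamma_1(G)=G$, $\gamma_2(G)=G'$), "nilpotent of class $n$" means $\gamma_{n+1}(G)=\{1\}$ (so class $2$ means $\gamma_3(G)=\{1\}$, i.e. class at most $2$; abelian groups are included). A double magma is a triple $(M,*,\bullet)$ where $M$ is a nonempty set and $*,\bullet$ are binary operations on $M$ satisfying the interchange law $(w*x)\bullet(y*z)=(w\bullet y)*(x\bullet z)$ for all $w,x,y,z\in M$. A double semigroup is a double magma in which both operations are associative. A double magma (or double semigroup) is proper if its two operations are distinct. *)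

theory Defs
  imports "HOL-Algebra.Generated_Groups"
begin

definition commutator :: "('a, 'b) monoid_scheme \<Rightarrow> 'a \<Rightarrow> 'a \<Rightarrow> 'a" where
  "commutator G x y = inv\<^bsub>G\<^esub> x \<otimes>\<^bsub>G\<^esub> inv\<^bsub>G\<^esub> y \<otimes>\<^bsub>G\<^esub> x \<otimes>\<^bsub>G\<^esub> y"

text \<open>Indexing starts at 1; the value at 0 is junk.\<close>
fun lower_central :: "('a, 'b) monoid_scheme \<Rightarrow> nat \<Rightarrow> 'a set" where
  "lower_central G 0 = carrier G"
| "lower_central G (Suc 0) = carrier G"
| "lower_central G (Suc (Suc n)) =
     generate G {commutator G x y | x y. x \<in> lower_central G (Suc n) \<and> y \<in> carrier G}"

text \<open>Class at most n; n need not be the least such number.\<close>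
definition nilpotent_of_class :: "('a, 'b) monoid_scheme \<Rightarrow> nat \<Rightarrow> bool" where
  "nilpotent_of_class G n \<longleftrightarrow> lower_central G (n + 1) = {\<one>\<^bsub>G\<^esub>}"

text \<open>The trivial group qualifies.\<close>
definition exponent_two :: "('a, 'b) monoid_scheme \<Rightarrow> bool" where
  "exponent_two H \<longleftrightarrow> (\<forall>x\<in>carrier H. x [^]\<^bsub>H\<^esub> (2::nat) = \<one>\<^bsub>H\<^esub>)"

definition double_magma :: "'a set \<Rightarrow> ('a \<Rightarrow> 'a \<Rightarrow> 'a) \<Rightarrow> ('a \<Rightarrow> 'a \<Rightarrow> 'a) \<Rightarrow> bool" where
  "double_magma M f g \<longleftrightarrow>
     M \<noteq> {} \<and> f \<in> M \<rightarrow> M \<rightarrow> M \<and> g \<in> M \<rightarrow> M \<rightarrow> M \<and>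
     (\<forall>w\<in>M. \<forall>x\<in>M. \<forall>y\<in>M. \<forall>z\<in>M. g (f w x) (f y z) = f (g w y) (g x z))"

definition assoc_on :: "'a set \<Rightarrow> ('a \<Rightarrow> 'a \<Rightarrow> 'a) \<Rightarrow> bool" where
  "assoc_on M f \<longleftrightarrow> (\<forall>x\<in>M. \<forall>y\<in>M. \<forall>z\<in>M. f (f x y) z = f x (f y z))"

definition double_semigroup :: "'a set \<Rightarrow> ('a \<Rightarrow> 'a \<Rightarrow> 'a) \<Rightarrow> ('a \<Rightarrow> 'a \<Rightarrow> 'a) \<Rightarrow> bool" where
  "double_semigroup M f g \<longleftrightarrow> double_magma M f g \<and> assoc_on M f \<and> assoc_on M g"

text \<open>The operations count as distinct only if they differ somewhere on M; their values outside
  M are irrelevant.\<close>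
definition proper_double_semigroup :: "'a set \<Rightarrow> ('a \<Rightarrow> 'a \<Rightarrow> 'a) \<Rightarrow> ('a \<Rightarrow> 'a \<Rightarrow> 'a) \<Rightarrow> bool" where
  "proper_double_semigroup M f g \<longleftrightarrow>
     double_semigroup M f g \<and> (\<exists>x\<in>M. \<exists>y\<in>M. f x y \<noteq> g x y)"

text \<open>The library's \<^const>\<open>derived\<close> is generated by the commutators
  \<open>x \<otimes> y \<otimes> inv x \<otimes> inv y\<close>; on the whole group this convention yields the same subgroup.\<close>
lemma (in group) lower_central_2: "lower_central G 2 = derived G (carrier G)"
proof -
  have "{commutator G x y | x y. x \<in> carrier G \<and> y \<in> carrier G} = derived_set G (carrier G)"
  proof (intro equalityI subsetI)
    fix c assume "c \<in> {commutator G x y | x y. x \<in> carrier G \<and> y \<in> carrier G}"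
    then obtain x y where xy: "x \<in> carrier G" "y \<in> carrier G" "c = commutator G x y" by blast
    then have "c = inv x \<otimes> inv y \<otimes> inv (inv x) \<otimes> inv (inv y)" by (simp add: commutator_def)
    with xy show "c \<in> derived_set G (carrier G)" by blast
  next
    fix c assume "c \<in> derived_set G (carrier G)"
    then obtain x y where xy: "x \<in> carrier G" "y \<in> carrier G" "c = x \<otimes> y \<otimes> inv x \<otimes> inv y"
      by blast
    then have "c = commutator G (inv x) (inv y)" by (simp add: commutator_def)
    with xy show "c \<in> {commutator G x y | x y. x \<in> carrier G \<and> y \<in> carrier G}" by blast
  qed
  then show ?thesis by (simp add: derived_def numeral_2_eq_2)
qed

end

theory Submission
  imports Defs
begin

text \<open>Everything reduces to one identity: both conditions in (i) say that every double commutator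
  \<open>[[x, y], z]\<close> is trivial.

  If double commutators vanish, then commutators are central, so both sides of the associative
  laws and of the interchange law equal \<open>1\<close>. Conversely, associativity of \<open>[x, y]\<close> forces
  double commutators to vanish. Write it as a product \<open>x * y\<close>. Since \<open>x * x = 1\<close> and \<open>1\<close> is a zero
  element for \<open>*\<close>, every product containing the same factor twice in a row is \<open>1\<close>; for instance
  \<open>[[a, b], [b, d]] = 1\<close>, so many commutators commute with each other. Now expand both sides of
  \<open>[x, y z] = [x, z y [y, z]]\<close> with \<open>[x, a b] = [x, b] [x, a] [[x, a], b]\<close>. Writing
  \<open>t = [[x, y], z]\<close>, which is also \<open>[x, [y, z]]\<close>, this gives
  \<open>[x, z] [x, y] t = t [x, y] [x, z] [[x, z], y]\<close>. As \<open>[x, y]\<close>, \<open>[x, z]\<close> and \<open>t\<close> commute, it follows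
  that \<open>[[x, z], y] = 1\<close>; this is \<open>double_commutator_trivial_of_assoc\<close>.

  For (ii), \<open>[y, x]\<close> is the inverse of \<open>[x, y]\<close>, so the two operations coincide exactly when all
  commutators square to \<open>1\<close>. When commutators are central, squaring is multiplicative on the
  subgroup that they generate, so this means that the derived group has exponent two.\<close>

context group
begin

section \<open>Commutator identities\<close>

lemma commutator_closed [simp, intro]:
  "x \<in> carrier G \<Longrightarrow> y \<in> carrier G \<Longrightarrow> commutator G x y \<in> carrier G"
  by (simp add: commutator_def)

lemma mult_inv_cancel:
  assumes "x \<in> carrier G" "y \<in> carrier G"
  shows "inv x \<otimes> (x \<otimes> y) = y" "x \<otimes> (inv x \<otimes> y) = y"
  using assms by (simp_all add: m_assoc [symmetric])

lemma mult_commutes: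
  assumes "a \<otimes> z = z \<otimes> a" "b \<otimes> z = z \<otimes> b"
    and [simp]: "a \<in> carrier G" "b \<in> carrier G" "z \<in> carrier G"
  shows "(a \<otimes> b) \<otimes> z = z \<otimes> (a \<otimes> b)"
proof -
  have "(a \<otimes> b) \<otimes> z = a \<otimes> (z \<otimes> b)"
    by (simp add: m_assoc assms)
  also have "\<dots> = z \<otimes> (a \<otimes> b)"
    by (simp add: assms flip: m_assoc)
  finally show ?thesis .
qed

lemma inv_commutes:
  assumes "a \<otimes> z = z \<otimes> a" and [simp]: "a \<in> carrier G" "z \<in> carrier G"
  shows "inv a \<otimes> z = z \<otimes> inv a"
proof -
  have "inv a \<otimes> (a \<otimes> z) \<otimes> inv a = inv a \<otimes> (z \<otimes> a) \<otimes> inv a"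
    by (simp only: assms)
  then show ?thesis
    by (simp add: m_assoc mult_inv_cancel)
qed

lemma commutator_swap:
  assumes "x \<in> carrier G" "y \<in> carrier G"
  shows "commutator G y x = inv (commutator G x y)"
  using assms by (simp add: commutator_def inv_mult_group m_assoc)

lemma mult_eq_mult_commutator:
  assumes "x \<in> carrier G" "y \<in> carrier G"
  shows "x \<otimes> y = y \<otimes> x \<otimes> commutator G x y"
  using assms by (simp add: commutator_def m_assoc mult_inv_cancel)

lemma commutator_eq_one_iff:
  assumes "x \<in> carrier G" "y \<in> carrier G"
  shows "commutator G x y = \<one> \<longleftrightarrow> x \<otimes> y = y \<otimes> x"
proof
  show "commutator G x y = \<one> \<Longrightarrow> x \<otimes> y = y \<otimes> x"
    using mult_eq_mult_commutator [OF assms] assms by simp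
  show "x \<otimes> y = y \<otimes> x \<Longrightarrow> commutator G x y = \<one>"
    using mult_eq_mult_commutator [OF assms] assms by simp
qed

lemma commutator_self [simp]: "x \<in> carrier G \<Longrightarrow> commutator G x x = \<one>"
  by (simp add: commutator_eq_one_iff)

lemma commutator_one [simp]:
  assumes "x \<in> carrier G"
  shows "commutator G x \<one> = \<one>" "commutator G \<one> x = \<one>"
  using assms by (simp_all add: commutator_eq_one_iff)

lemma commutator_mult_right:
  assumes "x \<in> carrier G" "y \<in> carrier G" "z \<in> carrier G"
  shows "commutator G x (y \<otimes> z)
    = commutator G x z \<otimes> commutator G x y \<otimes> commutator G (commutator G x y) z"
  using assms by (simp add: commutator_def inv_mult_group m_assoc mult_inv_cancel)

section \<open>Associativity of the commutator operation\<close>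

text \<open>The expansions of \<open>[x, y z]\<close> and \<open>[x, z y [y, z]]\<close> have the same factors, except that
  \<open>[[x, z], y]\<close> occurs only in the second: associativity makes the factor \<open>[[x, y], z]\<close> of the
  first equal to the factor \<open>[x, [y, z]]\<close> of the second, and makes the remaining term
  \<open>[[x, z y], [y, z]]\<close> trivial.\<close>

lemma double_commutator_trivial_of_assoc:
  assumes assoc: "assoc_on (carrier G) (commutator G)"
    and carr [simp]: "x \<in> carrier G" "y \<in> carrier G" "z \<in> carrier G"
  shows "commutator G (commutator G x z) y = \<one>"
proof -
  let ?c = "commutator G"
  have A: "?c (?c a b) d = ?c a (?c b d)"
    if "a \<in> carrier G" "b \<in> carrier G" "d \<in> carrier G" for a b d
    using assoc that by (simp add: assoc_on_def)
  have square_left: "?c a (?c a b) = \<one>" if "a \<in> carrier G" "b \<in> carrier G" for a b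
    using A [of a a b] that by simp
  have inner: "?c (?c a b) (?c b d) = \<one>"
    if "a \<in> carrier G" "b \<in> carrier G" "d \<in> carrier G" for a b d
    using that by (simp add: A square_left)
  \<comment> \<open>\<open>[b, a]\<close> commutes with \<open>[a, d]\<close> by the previous fact, hence so does its inverse \<open>[a, b]\<close>.\<close>
  have outer: "?c a b \<otimes> ?c a d = ?c a d \<otimes> ?c a b"
    if "a \<in> carrier G" "b \<in> carrier G" "d \<in> carrier G" for a b d
  proof -
    have "?c b a \<otimes> ?c a d = ?c a d \<otimes> ?c b a"
      using inner [of b a d] that by (simp add: commutator_eq_one_iff)
    then show ?thesis
      using inv_commutes [of "?c b a" "?c a d"] that by (simp add: commutator_swap [of b a])
  qed
  \<comment> \<open>The factors of the two expansions: \<open>[x, y z] = v u t\<close> and \<open>[x, (z y) d] = t (u v s)\<close>.\<close>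
  define t where "t = ?c (?c x y) z"
  define d where "d = ?c y z"
  define u where "u = ?c x y"
  define v where "v = ?c x z"
  define s where "s = ?c v y"
  have [simp]: "t \<in> carrier G" "d \<in> carrier G" "u \<in> carrier G" "v \<in> carrier G" "s \<in> carrier G"
    by (simp_all add: t_def d_def u_def v_def s_def)
  have t: "?c x d = t"
    by (simp add: A t_def d_def)
  have u_d: "u \<otimes> d = d \<otimes> u"
    using inner [of x y z] by (simp add: commutator_eq_one_iff u_def d_def)
  \<comment> \<open>\<open>v\<close> and \<open>d\<close> are the inverses of \<open>[z, x]\<close> and \<open>[z, y]\<close>, which commute.\<close>
  have v_d: "v \<otimes> d = d \<otimes> v"
    using outer [of z x y] inv_commutes [of "?c z x" "inv (?c z y)"]
      inv_commutes [of "?c z y" "?c z x"]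
    by (simp add: v_def d_def commutator_swap [of z x] commutator_swap [of z y])
  have s_d: "s \<otimes> d = d \<otimes> s"
    using inner [of v y z] by (simp add: commutator_eq_one_iff s_def d_def)
  have xzy: "?c x (z \<otimes> y) = u \<otimes> v \<otimes> s"
    by (simp add: commutator_mult_right u_def v_def s_def)
  have "u \<otimes> v \<otimes> s \<otimes> d = d \<otimes> (u \<otimes> v \<otimes> s)"
    by (intro mult_commutes u_d v_d s_d) simp_all
  then have "?c (?c x (z \<otimes> y)) d = \<one>"
    by (simp add: xzy commutator_eq_one_iff)
  then have "?c x (y \<otimes> z) = t \<otimes> (u \<otimes> v \<otimes> s)"
    using mult_eq_mult_commutator [of y z] commutator_mult_right [of x "z \<otimes> y" d]
    by (simp add: t xzy flip: d_def)
  moreover have "?c x (y \<otimes> z) = v \<otimes> u \<otimes> t"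
    by (simp add: commutator_mult_right u_def v_def t_def)
  moreover have "v \<otimes> u = u \<otimes> v" and t_u: "u \<otimes> t = t \<otimes> u" and t_v: "v \<otimes> t = t \<otimes> v"
    using outer [of x z y] outer [of x y d] outer [of x z d] by (simp_all add: u_def v_def t)
  moreover have "u \<otimes> v \<otimes> t = t \<otimes> (u \<otimes> v)"
    by (intro mult_commutes t_u t_v) simp_all
  ultimately have "t \<otimes> (u \<otimes> v) = t \<otimes> (u \<otimes> v) \<otimes> s"
    by (simp add: m_assoc)
  then have "s = \<one>"
    by simp
  then show ?thesis
    by (simp add: s_def v_def)
qed

section \<open>Nilpotency class two\<close>

lemma generate_commutes:
  assumes "S \<subseteq> carrier G" "z \<in> carrier G" "\<And>s. s \<in> S \<Longrightarrow> s \<otimes> z = z \<otimes> s"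
    and "u \<in> generate G S"
  shows "u \<otimes> z = z \<otimes> u"
  using assms(4)
proof induction
  case one
  then show ?case using assms(2) by simp
next
  case (incl h)
  then show ?case using assms(3) by simp
next
  case (inv h)
  have "h \<in> carrier G" "h \<otimes> z = z \<otimes> h"
    using inv assms by auto
  with assms(2) show ?case
    by (simp add: inv_commutes)
next
  case (eng h1 h2)
  have "h1 \<in> carrier G" "h2 \<in> carrier G"
    using eng.hyps generate_in_carrier [OF assms(1)] by auto
  with eng.IH assms(2) show ?case
    by (simp add: mult_commutes)
qed

text \<open>The second and third terms of the lower central series are generated subgroups, so the nontrivial
  point is that an element commuting with all commutators commutes with the whole derived group.\<close>

lemma nilpotent_of_class_2_iff:
  "nilpotent_of_class G 2 \<longleftrightarrow>
    (\<forall>x\<in>carrier G. \<forall>y\<in>carrier G. \<forall>z\<in>carrier G. commutator G (commutator G x y) z = \<one>)"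
  (is "_ \<longleftrightarrow> ?R")
proof -
  let ?S = "{commutator G x y | x y. x \<in> carrier G \<and> y \<in> carrier G}"
  let ?T = "{commutator G u z | u z. u \<in> generate G ?S \<and> z \<in> carrier G}"
  have nil: "nilpotent_of_class G 2 \<longleftrightarrow> generate G ?T = {\<one>}"
    by (simp add: nilpotent_of_class_def numeral_2_eq_2)
  have S: "?S \<subseteq> carrier G"
    by auto
  show ?thesis
  proof
    assume triv: "nilpotent_of_class G 2"
    show ?R
    proof (intro ballI)
      fix x y z assume xyz: "x \<in> carrier G" "y \<in> carrier G" "z \<in> carrier G"
      then have "commutator G x y \<in> generate G ?S"
        by (intro generate.incl) auto
      with xyz have "commutator G (commutator G x y) z \<in> generate G ?T"
        by (intro generate.incl) auto
      with triv show "commutator G (commutator G x y) z = \<one>"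
        by (simp only: nil) simp
    qed
  next
    assume R: ?R
    have "commutator G u z = \<one>" if u: "u \<in> generate G ?S" and z: "z \<in> carrier G" for u z
    proof -
      have "s \<otimes> z = z \<otimes> s" if "s \<in> ?S" for s
      proof -
        have "commutator G s z = \<one>" "s \<in> carrier G"
          using that R z by auto
        with z show ?thesis
          by (simp add: commutator_eq_one_iff)
      qed
      then show ?thesis
        using generate_commutes [OF S z _ u] generate_in_carrier [OF S u] z
        by (simp add: commutator_eq_one_iff)
    qed
    then have "?T \<subseteq> {\<one>}"
      by auto
    then have "generate G ?T \<subseteq> {\<one>}"
      by (rule generate_subgroup_incl) (rule triv_subgroup)
    then show "nilpotent_of_class G 2"
      unfolding nil using generate.one by blast
  qed
qed

text \<open>When double commutators are trivial, both operations take the value \<open>1\<close> as soon as one argument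
  is a commutator, which is the case on both sides of all the laws.\<close>

lemma double_semigroup_commutator_iff:
  "double_semigroup (carrier G) (\<lambda>x y. commutator G x y) (\<lambda>x y. commutator G y x)
    \<longleftrightarrow> nilpotent_of_class G 2"
proof
  assume "double_semigroup (carrier G) (\<lambda>x y. commutator G x y) (\<lambda>x y. commutator G y x)"
  then have "assoc_on (carrier G) (commutator G)"
    by (simp add: double_semigroup_def)
  then show "nilpotent_of_class G 2"
    by (simp add: nilpotent_of_class_2_iff double_commutator_trivial_of_assoc)
next
  assume "nilpotent_of_class G 2"
  then have left: "commutator G (commutator G x y) z = \<one>"
    if "x \<in> carrier G" "y \<in> carrier G" "z \<in> carrier G" for x y z
    using that by (simp add: nilpotent_of_class_2_iff)
  have right: "commutator G z (commutator G x y) = \<one>"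
    if "x \<in> carrier G" "y \<in> carrier G" "z \<in> carrier G" for x y z
    using that commutator_swap [of "commutator G x y" z] by (simp add: left)
  show "double_semigroup (carrier G) (\<lambda>x y. commutator G x y) (\<lambda>x y. commutator G y x)"
    by (auto simp: double_semigroup_def double_magma_def assoc_on_def left right)
qed

section \<open>Exponent of the derived group\<close>

lemma commutator_eq_swap_iff:
  assumes "x \<in> carrier G" "y \<in> carrier G"
  shows "commutator G x y = commutator G y x
    \<longleftrightarrow> commutator G x y \<otimes> commutator G x y = \<one>"
proof
  show "commutator G x y \<otimes> commutator G x y = \<one>" if "commutator G x y = commutator G y x"
  proof -
    have "inv (commutator G x y) = commutator G x y"
      using that assms by (simp only: commutator_swap [of x y])
    then show ?thesis
      using r_inv [of "commutator G x y"] assms by simp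
  qed
  show "commutator G x y = commutator G y x" if "commutator G x y \<otimes> commutator G x y = \<one>"
    using inv_equality [OF that] assms by (simp add: commutator_swap [of x y])
qed

text \<open>Commutators are central here, so squaring is multiplicative on the derived group and it
  suffices to look at generators.\<close>

lemma exponent_two_derived_iff:
  assumes "nilpotent_of_class G 2"
  shows "exponent_two (G\<lparr>carrier := derived G (carrier G)\<rparr>) \<longleftrightarrow>
    (\<forall>x\<in>carrier G. \<forall>y\<in>carrier G. commutator G x y = commutator G y x)"
proof -
  let ?S = "{commutator G x y | x y. x \<in> carrier G \<and> y \<in> carrier G}"
  have S: "?S \<subseteq> carrier G"
    by auto
  have derived: "derived G (carrier G) = generate G ?S"
    using lower_central_2 by (simp add: numeral_2_eq_2)
  have pow: "x [^]\<^bsub>G\<lparr>carrier := H\<rparr>\<^esub> (2::nat) = x \<otimes> x" if "x \<in> carrier G" for x H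
    using that by (simp add: numeral_2_eq_2 nat_pow_def)
  have exp: "exponent_two (G\<lparr>carrier := derived G (carrier G)\<rparr>)
      \<longleftrightarrow> (\<forall>u\<in>generate G ?S. u \<otimes> u = \<one>)"
  proof -
    have "x [^]\<^bsub>G\<lparr>carrier := generate G ?S\<rparr>\<^esub> (2::nat) = x \<otimes> x" if "x \<in> generate G ?S" for x
      by (rule pow) (rule generate_in_carrier [OF S that])
    then show ?thesis
      by (simp add: exponent_two_def derived cong: ball_cong)
  qed
  have comm: "u \<otimes> z = z \<otimes> u" if "u \<in> generate G ?S" "z \<in> carrier G" for u z
  proof (rule generate_commutes [OF S that(2) _ that(1)])
    show "s \<otimes> z = z \<otimes> s" if "s \<in> ?S" for s
    proof -
      have "commutator G s z = \<one>" "s \<in> carrier G"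
        using that assms \<open>z \<in> carrier G\<close> by (auto simp: nilpotent_of_class_2_iff)
      with \<open>z \<in> carrier G\<close> show ?thesis
        by (simp add: commutator_eq_one_iff)
    qed
  qed
  show ?thesis
  proof
    assume e2: "exponent_two (G\<lparr>carrier := derived G (carrier G)\<rparr>)"
    show "\<forall>x\<in>carrier G. \<forall>y\<in>carrier G. commutator G x y = commutator G y x"
    proof (intro ballI)
      fix x y assume xy: "x \<in> carrier G" "y \<in> carrier G"
      then have "commutator G x y \<in> generate G ?S"
        by (intro generate.incl) auto
      with e2 xy show "commutator G x y = commutator G y x"
        by (simp only: exp commutator_eq_swap_iff)
    qed
  next
    assume eq: "\<forall>x\<in>carrier G. \<forall>y\<in>carrier G. commutator G x y = commutator G y x"
    have gen: "s \<otimes> s = \<one>" if s: "s \<in> ?S" for s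
    proof -
      obtain x y where "s = commutator G x y" "x \<in> carrier G" "y \<in> carrier G"
        using s by blast
      then show ?thesis
        using eq commutator_eq_swap_iff [of x y] by simp
    qed
    have "u \<otimes> u = \<one>" if "u \<in> generate G ?S" for u
      using that
    proof induction
      case one
      then show ?case by simp
    next
      case (incl h)
      then show ?case by (rule gen)
    next
      case (inv h)
      then have "h \<in> carrier G" and "h \<otimes> h = \<one>"
        by (rule subsetD [OF S], rule gen)
      then have "inv h = h"
        by (intro inv_equality)
      with \<open>h \<otimes> h = \<one>\<close> show ?case
        by (simp only:)
    next
      case (eng h1 h2)
      have carr: "h1 \<in> carrier G" "h2 \<in> carrier G"
        by (rule generate_in_carrier [OF S eng.hyps(1)], rule generate_in_carrier [OF S eng.hyps(2)])
      have "(h1 \<otimes> h2) \<otimes> (h1 \<otimes> h2) = (h1 \<otimes> h2) \<otimes> (h2 \<otimes> h1)"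
        by (rule arg_cong [OF comm [OF eng.hyps(1) carr(2)]])
      also have "\<dots> = h1 \<otimes> ((h2 \<otimes> h2) \<otimes> h1)"
        using carr by (simp add: m_assoc)
      also have "\<dots> = \<one>"
        using carr eng.IH by simp
      finally show ?case .
    qed
    then show "exponent_two (G\<lparr>carrier := derived G (carrier G)\<rparr>)"
      unfolding exp by blast
  qed
qed

end

theorem corollary1p8:
  fixes G :: "('a, 'b) monoid_scheme"
  assumes "group G"
  shows "(double_semigroup (carrier G) (\<lambda>x y. commutator G x y) (\<lambda>x y. commutator G y x)
            \<longleftrightarrow> nilpotent_of_class G 2) \<and>
         (proper_double_semigroup (carrier G) (\<lambda>x y. commutator G x y) (\<lambda>x y. commutator G y x)
            \<longleftrightarrow> \<not> comm_group G \<and> nilpotent_of_class G 2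
              \<and> \<not> exponent_two (G\<lparr>carrier := derived G (carrier G)\<rparr>))"
proof -
  interpret group G by (rule assms)
  have "\<not> comm_group G"
    if "x \<in> carrier G" "y \<in> carrier G" "commutator G x y \<noteq> commutator G y x" for x y
  proof
    assume "comm_group G"
    then interpret comm_group G .
    from that show False
      by (metis commutator_eq_one_iff m_comm)
  qed
  then show ?thesis
    using exponent_two_derived_iff
    by (auto simp: double_semigroup_commutator_iff proper_double_semigroup_def)
qed

end
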